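(* Let $Y\subseteq\mathbb{U}^*$ be a cycle property such that $Y$ is closed under cyclic permutations and both $Y$ and $\neg Y=\mathbb{U}^*\setminus Y$ are closed under concatenation. Then every arena $\mathcal{A}$ with labels in $\mathbb{U}$ is $Y$-unambiguous.
   Context: An arena is a tuple $\mathcal{A}=(V_0,V_1,E,\mathbb{U},\lambda)$ where $V_0,V_1$ are disjoint finite sets with $V:=V_0\cup V_1$ non-empty, $E\subseteq V\times V$ is a set of edges such that every vertex has at least one outgoing edge, $\mathbb{U}$ is a set of labels, and $\lambda:E\to\mathbb{U}$. For a sequence of edges $u=e_1e_2\cdots$, write $\lambda(u)=\lambda(e_1)\lambda(e_2)\cdots$. A play is an infinite sequence $\pi=\pi_0\pi_1\cdots$ of vertices with $(\pi_j,\pi_{j+1})\in E$ for all $j$; a suffix of $\pi$ is a play $\pi_j\pi_{j+1}\cdots$ for some $j\ge0$. A cycle is a sequence of edges $(v_1,v_2)(v_2,v_3)\cdots(v_{k-1},v_k)(v_k,v_1)$. The cycles-decomposition $\mathrm{cycles}(\pi)$ of a play $\pi$ is the sequence of cycles output by the following procedure: start with an empty stack; at step $j=0,1,2,\dots$ push the edge $(\pi_j,\pi_{j+1})$, and if for some $k$ the top $k$ edges of the stack form a cycle, pop this cycle and output it. A cycle property is a set $Y\subseteq\mathbb{U}^*$. $Y$ is closed under cyclic permutations if $ab\in Y$ implies $ba\in Y$ for all $a\in\mathbb{U}$, $b\in\mathbb{U}^*$. A set $Z\subseteq\mathbb{U}^*$ is closed under concatenation if $a\in Z$ and $b\in Z$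 imply $ab\in Z$ for all $a,b\in\mathbb{U}^*$. $O_{\mathrm{EAC}(Y)}(\mathcal{A})$ is the set of plays $\pi$ having some suffix $\pi'$ such that $\lambda(u)\in Y$ for every cycle $u$ in $\mathrm{cycles}(\pi')$. The arena $\mathcal{A}$ is $Y$-unambiguous if $O_{\mathrm{EAC}(Y)}(\mathcal{A})\cap O_{\mathrm{EAC}(\neg Y)}(\mathcal{A})=\emptyset$. *)

theory Defs
  imports Main "HOL-Library.Omega_Words_Fun"
begin

record ('v, 'u) arena =
  verts0 :: "'v set"
  verts1 :: "'v set"
  edges :: "('v \<times> 'v) set"
  labels :: "'u set"
  lab :: "'v \<times> 'v \<Rightarrow> 'u"

definition verts :: "('v, 'u) arena \<Rightarrow> 'v set" where
  "verts A = verts0 A \<union> verts1 A"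

text \<open>The labelling is a total HOL function; its values outside \<^term>\<open>edges A\<close> are irrelevant.\<close>

definition is_arena :: "('v, 'u) arena \<Rightarrow> bool" where
  "is_arena A \<longleftrightarrow>
     finite (verts0 A) \<and> finite (verts1 A) \<and> verts0 A \<inter> verts1 A = {} \<and> verts A \<noteq> {} \<and>
     edges A \<subseteq> verts A \<times> verts A \<and>
     (\<forall>v \<in> verts A. \<exists>w. (v, w) \<in> edges A) \<and>
     (\<forall>e \<in> edges A. lab A e \<in> labels A)"

definition is_play :: "('v, 'u) arena \<Rightarrow> 'v word \<Rightarrow> bool" where
  "is_play A \<pi> \<longleftrightarrow> (\<forall>j. (\<pi> j, \<pi> (Suc j)) \<in> edges A)"

text \<open>For \<open>vs = [v\<^sub>1, \<dots>, v\<^sub>k]\<close> the list \<open>zip vs (rotate1 vs)\<close> is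
  \<open>[(v\<^sub>1, v\<^sub>2), \<dots>, (v\<^sub>k, v\<^sub>1)]\<close>. Cycles are non-empty; they need not be simple.\<close>

definition is_cycle :: "('v, 'u) arena \<Rightarrow> ('v \<times> 'v) list \<Rightarrow> bool" where
  "is_cycle A u \<longleftrightarrow>
     set u \<subseteq> edges A \<and> (\<exists>vs. vs \<noteq> [] \<and> u = zip vs (rotate1 vs))"

text \<open>Stacks are lists whose last element is the top, so that the edges on a stack
  appear in the order in which the play traverses them.\<close>

definition top_edges :: "nat \<Rightarrow> 'e list \<Rightarrow> 'e list" where
  "top_edges k s = drop (length s - k) s"

definition pop_edges :: "nat \<Rightarrow> 'e list \<Rightarrow> 'e list" where
  "pop_edges k s = take (length s - k) s"

text \<open>One step: push an edge, then pop and output a cycle on top of the stack, if there is one.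
  Along a play the stack before a push is always a path that visits no vertex twice,
  so at most one \<open>k\<close> qualifies and \<open>LEAST\<close> involves no choice.\<close>

definition cycle_step ::
  "('v, 'u) arena \<Rightarrow> ('v \<times> 'v) list \<Rightarrow> 'v \<times> 'v \<Rightarrow> ('v \<times> 'v) list \<times> ('v \<times> 'v) list option" where
  "cycle_step A s e =
     (let s' = s @ [e];
          P = (\<lambda>k. k \<le> length s' \<and> is_cycle A (top_edges k s'));
          k = (LEAST k. P k)
      in if \<exists>k. P k then (pop_edges k s', Some (top_edges k s')) else (s', None))"

primrec stack :: "('v, 'u) arena \<Rightarrow> 'v word \<Rightarrow> nat \<Rightarrow> ('v \<times> 'v) list" where
  "stack A \<pi> 0 = []"
| "stack A \<pi> (Suc j) = fst (cycle_step A (stack A \<pi> j) (\<pi> j, \<pi> (Suc j)))"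

text \<open>The cycles-decomposition as a sequence indexed by the steps of the procedure:
  entry \<open>j\<close> is \<open>Some u\<close> if step \<open>j\<close> outputs the cycle \<open>u\<close>, and \<open>None\<close> if it outputs nothing.\<close>

definition cycles :: "('v, 'u) arena \<Rightarrow> 'v word \<Rightarrow> ('v \<times> 'v) list option word" where
  "cycles A \<pi> j = snd (cycle_step A (stack A \<pi> j) (\<pi> j, \<pi> (Suc j)))"

definition closed_under_cyclic_permutations :: "'u set \<Rightarrow> 'u list set \<Rightarrow> bool" where
  "closed_under_cyclic_permutations U Y \<longleftrightarrow>
     (\<forall>a \<in> U. \<forall>b \<in> lists U. a # b \<in> Y \<longrightarrow> b @ [a] \<in> Y)"

definition closed_under_concatenation :: "'u set \<Rightarrow> 'u list set \<Rightarrow> bool" where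
  "closed_under_concatenation U Z \<longleftrightarrow>
     (\<forall>a \<in> lists U. \<forall>b \<in> lists U. a \<in> Z \<longrightarrow> b \<in> Z \<longrightarrow> a @ b \<in> Z)"

definition O_EAC :: "'u list set \<Rightarrow> ('v, 'u) arena \<Rightarrow> 'v word set" where
  "O_EAC Y A =
     {\<pi>. is_play A \<pi> \<and>
         (\<exists>j. \<forall>u. Some u \<in> range (cycles A (suffix j \<pi>)) \<longrightarrow> map (lab A) u \<in> Y)}"

definition unambiguous :: "'u list set \<Rightarrow> ('v, 'u) arena \<Rightarrow> bool" where
  "unambiguous Y A \<longleftrightarrow> O_EAC Y A \<inter> O_EAC (lists (labels A) - Y) A = {}"

end

theory Submission
  imports Defs
begin

text \<open>Run the cycles-decomposition on both suffixes simultaneously. Since stacks are simple paths in a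
  finite graph, there are two times at which both stacks are repeated. The segment of the play between
  these times is, up to rotation, obtained from the empty word by inserting output cycles. As \<open>Y\<close> and
  \<open>\<not> Y\<close> are closed under rotation and concatenation, they are closed under such insertions, so
  the label of the segment lies in both.\<close>

section \<open>Sets of words closed under insertion\<close>

locale rotation_concatenation_closed =
  fixes Z :: "'e list set"
  assumes Nil: "[] \<in> Z"
    and rotation: "a @ b \<in> Z \<Longrightarrow> b @ a \<in> Z"
    and concatenation: "a \<in> Z \<Longrightarrow> b \<in> Z \<Longrightarrow> a @ b \<in> Z"
begin

text \<open>Rotation brings the insertion point to the end, where concatenation adds
  \<open>c\<close>; a second rotation restores the order.\<close>

lemma insertion:
  assumes "a @ b \<in> Z" "c \<in> Z"
  shows "a @ c @ b \<in> Z"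
proof -
  have "(b @ a) @ c \<in> Z"
    using assms rotation concatenation by blast
  then show ?thesis
    using rotation[of b "a @ c"] by simp
qed

text \<open>A semantic form of "\<open>w\<close> arises from \<open>w'\<close> by inserting words of
  \<open>Z\<close>". Keeping only the effect on membership, in every context, gives a preorder
  compatible with concatenation.\<close>

definition reduces :: "'e list \<Rightarrow> 'e list \<Rightarrow> bool" where
  "reduces w w' \<longleftrightarrow> (\<forall>a b. a @ w' @ b \<in> Z \<longrightarrow> a @ w @ b \<in> Z)"

lemma reduces_refl: "reduces w w"
  by (simp add: reduces_def)

lemma reduces_trans: "reduces u v \<Longrightarrow> reduces v w \<Longrightarrow> reduces u w"
  by (simp add: reduces_def)

lemma reduces_context: "reduces w w' \<Longrightarrow> reduces (a @ w @ b) (a @ w' @ b)"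
  unfolding reduces_def by (metis append.assoc)

lemma reduces_delete: "c \<in> Z \<Longrightarrow> reduces (a @ c) a"
  unfolding reduces_def by (metis append.assoc insertion)

lemma mem_if_reduces_Nil: "reduces w [] \<Longrightarrow> w \<in> Z"
  using Nil unfolding reduces_def by (metis append_Nil append_Nil2)

text \<open>The common prefix \<open>p\<close> of the two stacks is what has not been touched since time \<open>m\<close>. The word \<open>x\<close>
  is read until \<open>q\<close> has been popped, and \<open>y\<close> is read afterwards, building up \<open>q'\<close>.\<close>

lemma stack_segment:
  fixes st :: "nat \<Rightarrow> 'e list" and e :: "nat \<Rightarrow> 'e"
  assumes step: "\<And>j. st (Suc j) = st j @ [e j] \<or> (\<exists>c\<in>Z. st j @ [e j] = st (Suc j) @ c)"
    and "m \<le> n"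
  shows "\<exists>p q q' x y. st m = p @ q \<and> st n = p @ q' \<and> map e [m..<n] = x @ y \<and>
           reduces (q @ x) [] \<and> reduces y q'"
  using \<open>m \<le> n\<close>
proof (induction n rule: dec_induct)
  case base
  show ?case
    by (rule exI[of _ "st m"]) (simp add: reduces_refl)
next
  case (step n)
  then obtain p q q' x y where IH: "st m = p @ q" "st n = p @ q'" "map e [m..<n] = x @ y"
    "reduces (q @ x) []" "reduces y q'"
    by blast
  have word: "map e [m..<Suc n] = x @ y @ [e n]"
    using IH(3) step.hyps by simp
  have push: "reduces (y @ [e n]) (q' @ [e n])"
    using reduces_context[OF IH(5), of "[]" "[e n]"] by simp
  from assms(1)[of n] show ?case
  proof (elim disjE bexE)
    assume "st (Suc n) = st n @ [e n]"
    then have "st (Suc n) = p @ (q' @ [e n])"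
      using IH(2) by simp
    with IH word push show ?thesis
      by blast
  next
    fix c
    assume c: "c \<in> Z" "st n @ [e n] = st (Suc n) @ c"
    then have "p @ (q' @ [e n]) = st (Suc n) @ c"
      using IH(2) by simp
    \<comment> \<open>Either the popped cycle lies above \<open>p\<close>, or it cuts off a top part
      \<open>r\<close> of \<open>p\<close> as well.\<close>
    then consider r where "st (Suc n) = p @ r" "q' @ [e n] = r @ c"
      | r where "p = st (Suc n) @ r" "c = r @ q' @ [e n]"
      unfolding append_eq_append_conv2[of p] by metis
    then show ?thesis
    proof cases
      case 1
      then have "reduces (y @ [e n]) r"
        using push reduces_delete[OF c(1), of r] reduces_trans by metis
      with IH word 1 show ?thesis
        by blast
    next
      case 2
      \<comment> \<open>Now \<open>r @ q\<close> is what has been popped since time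
        \<open>m\<close>; the whole word becomes the new \<open>x\<close>, and the new
        \<open>y\<close> and \<open>q'\<close> are empty.\<close>
      have "reduces (r @ q @ x @ y @ [e n]) (r @ y @ [e n])"
        using reduces_context[OF IH(4), of r "y @ [e n]"] by simp
      moreover have "reduces (r @ y @ [e n]) c"
        using reduces_context[OF push, of r "[]"] 2 by simp
      moreover have "reduces c []"
        using reduces_delete[OF c(1), of "[]"] by simp
      ultimately have "reduces ((r @ q) @ x @ y @ [e n]) []"
        using reduces_trans by (metis append.assoc)
      moreover have "st m = st (Suc n) @ (r @ q)"
        using IH(1) 2 by simp
      ultimately show ?thesis
        using word reduces_refl[of "[]"] by (metis append_Nil2)
    qed
  qed
qed

text \<open>Equal stacks force \<open>q = q'\<close>, so the rotation \<open>y @ x\<close> of the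
  segment reduces to \<open>q @ x\<close> and hence to the empty word.\<close>

lemma segment_between_equal_stacks:
  fixes st :: "nat \<Rightarrow> 'e list" and e :: "nat \<Rightarrow> 'e"
  assumes "\<And>j. st (Suc j) = st j @ [e j] \<or> (\<exists>c\<in>Z. st j @ [e j] = st (Suc j) @ c)"
    and "m \<le> n" "st m = st n"
  shows "map e [m..<n] \<in> Z"
proof -
  obtain p q q' x y where *: "st m = p @ q" "st n = p @ q'" "map e [m..<n] = x @ y"
    "reduces (q @ x) []" "reduces y q'"
    using stack_segment[of st e, OF assms(1,2)] by blast
  have "q' = q"
    using * assms(3) by simp
  then have "reduces (y @ x) (q @ x)"
    using reduces_context[OF *(5), of "[]" x] by simp
  then have "y @ x \<in> Z"
    using *(4) mem_if_reduces_Nil reduces_trans by blast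
  then show ?thesis
    using * rotation by simp
qed

end

section \<open>Closure properties of label languages\<close>

lemma cyclic_permutation_append:
  assumes "closed_under_cyclic_permutations U Y" "Y \<subseteq> lists U" "x @ y \<in> Y"
  shows "y @ x \<in> Y"
  using assms(3)
proof (induction x arbitrary: y)
  case (Cons a x)
  then have "a \<in> U" "x @ y \<in> lists U"
    using assms(2) by auto
  then have "x @ y @ [a] \<in> Y"
    using assms(1) Cons.prems unfolding closed_under_cyclic_permutations_def
    by (metis append.assoc append_Cons)
  from Cons.IH[OF this] show ?case
    by simp
qed simp

text \<open>The locale demands the empty word, which cannot lie in both \<open>Y\<close> and its
  complement. It is therefore adjoined; this is harmless for nonempty segments.\<close>

lemma rotation_concatenation_closed_labels:
  assumes "X \<subseteq> lists U" "closed_under_concatenation U X"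
    and "\<And>x y. x @ y \<in> X \<Longrightarrow> y @ x \<in> X"
  shows "rotation_concatenation_closed {w. map f w \<in> insert [] X}"
proof
  fix a b
  assume "a @ b \<in> {w. map f w \<in> insert [] X}"
  then show "b @ a \<in> {w. map f w \<in> insert [] X}"
    using assms(3)[of "map f a" "map f b"] by auto
next
  fix a b
  assume "a \<in> {w. map f w \<in> insert [] X}" "b \<in> {w. map f w \<in> insert [] X}"
  then show "a @ b \<in> {w. map f w \<in> insert [] X}"
    using assms(1,2) subsetD[OF assms(1)] unfolding closed_under_concatenation_def
    by (cases "a = []"; cases "b = []") auto
qed simp

section \<open>Stacks as simple paths\<close>

text \<open>An interface to \<open>cycle_step\<close> in terms of suffixes instead of
  \<open>k\<close>. The push case records that no cycle lies on top, which keeps the path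
  simple.\<close>

lemma stack_cases:
  obtains (push) "stack A \<pi> (Suc j) = stack A \<pi> j @ [(\<pi> j, \<pi> (Suc j))]"
      "\<And>p u. stack A \<pi> j @ [(\<pi> j, \<pi> (Suc j))] = p @ u \<Longrightarrow> \<not> is_cycle A u"
  | (pop) u where "cycles A \<pi> j = Some u" "is_cycle A u"
      "stack A \<pi> j @ [(\<pi> j, \<pi> (Suc j))] = stack A \<pi> (Suc j) @ u"
proof -
  define s where "s = stack A \<pi> j @ [(\<pi> j, \<pi> (Suc j))]"
  define P where "P = (\<lambda>k. k \<le> length s \<and> is_cycle A (top_edges k s))"
  have step: "cycle_step A (stack A \<pi> j) (\<pi> j, \<pi> (Suc j)) =
    (if \<exists>k. P k then (pop_edges (LEAST k. P k) s, Some (top_edges (LEAST k. P k) s)) else (s, None))"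
    unfolding cycle_step_def Let_def s_def P_def by simp
  show thesis
  proof (cases "\<exists>k. P k")
    case True
    then have "P (LEAST k. P k)"
      by (rule LeastI_ex)
    then show thesis
      using True step pop[of "top_edges (LEAST k. P k) s"]
      by (simp add: cycles_def P_def pop_edges_def top_edges_def flip: s_def)
  next
    case False
    have "\<not> is_cycle A u" if "s = p @ u" for p u
      using False that by (auto simp: P_def top_edges_def dest: spec[of _ "length u"])
    with False show thesis
      using step push by (simp flip: s_def)
  qed
qed

lemma is_cycle_endpoints:
  assumes "is_cycle A u"
  shows "u \<noteq> [] \<and> fst (hd u) = snd (last u)"
proof -
  obtain vs where "vs \<noteq> []" "u = zip vs (rotate1 vs)"
    using assms unfolding is_cycle_def by blast
  then show ?thesis
    by (cases vs) (auto simp: last_conv_nth nth_append hd_conv_nth)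
qed

text \<open>Truncates a path at its vertex \<open>x\<close>, as a pop does to the stack.\<close>

lemma take_zip_tl:
  "take (length p) (zip (p @ x # r) (tl (p @ x # r @ q))) = zip p (tl (p @ [x]))"
  by (cases p) (simp_all add: take_zip)

text \<open>The path runs through \<open>vs\<close> and ends in the current vertex. Pushing an edge
  back to a vertex on it would put a cycle on top, and a pop only shortens the path.\<close>

lemma stack_simple_path:
  assumes "is_play A \<pi>"
  shows "\<exists>vs. distinct (vs @ [\<pi> j]) \<and> stack A \<pi> j = zip vs (tl (vs @ [\<pi> j])) \<and>
           set (stack A \<pi> j) \<subseteq> edges A"
proof (induction j)
  case 0
  show ?case
    by (rule exI[of _ "[]"]) simp
next
  case (Suc j)
  then obtain vs where vs: "distinct (vs @ [\<pi> j])" "stack A \<pi> j = zip vs (tl (vs @ [\<pi> j]))"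
    "set (stack A \<pi> j) \<subseteq> edges A"
    by blast
  define ws where "ws = vs @ [\<pi> j]"
  have edge: "(\<pi> j, \<pi> (Suc j)) \<in> edges A"
    using assms by (simp add: is_play_def)
  have "tl (ws @ [\<pi> (Suc j)]) = tl ws @ [\<pi> (Suc j)]"
    by (cases vs) (simp_all add: ws_def)
  then have pushed: "stack A \<pi> j @ [(\<pi> j, \<pi> (Suc j))] = zip ws (tl (ws @ [\<pi> (Suc j)]))"
    using zip_append[of vs "tl ws" "[\<pi> j]" "[\<pi> (Suc j)]"] vs(2)
    by (simp flip: ws_def) (simp add: ws_def)
  show ?case
  proof (cases rule: stack_cases[of A \<pi> j])
    case push
    have "\<pi> (Suc j) \<notin> set ws"
    proof
      assume "\<pi> (Suc j) \<in> set ws"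
      then obtain xs ys where split: "ws = xs @ \<pi> (Suc j) # ys"
        by (meson split_list)
      let ?u = "zip (\<pi> (Suc j) # ys) (rotate1 (\<pi> (Suc j) # ys))"
      have "stack A \<pi> j @ [(\<pi> j, \<pi> (Suc j))] = zip xs (tl (xs @ [\<pi> (Suc j)])) @ ?u"
        using pushed split by (cases xs) (simp_all flip: zip_append)
      moreover from this have "is_cycle A ?u"
        using vs(3) edge unfolding is_cycle_def
        by (metis (no_types, lifting) Un_subset_iff empty_subsetI insert_subset list.distinct(1)
            list.set(1,2) set_append)
      ultimately show False
        using push(2) by blast
    qed
    moreover have "set (stack A \<pi> (Suc j)) \<subseteq> edges A"
      unfolding push(1) using vs(3) edge by simp
    ultimately show ?thesis
      using push(1) pushed vs(1) by (intro exI[of _ ws]) (simp flip: ws_def)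
  next
    case (pop u)
    let ?s = "stack A \<pi> (Suc j)"
    have u: "u \<noteq> []" "fst (hd u) = snd (last u)"
      using is_cycle_endpoints[OF pop(2)] by auto
    \<comment> \<open>The cycle starts where its last edge, the one just pushed, ends; so the path
      is cut at \<open>\<pi> (Suc j)\<close>.\<close>
    have "last u = (\<pi> j, \<pi> (Suc j))"
      using pop(3) u(1) by (metis last_appendR last_snoc)
    then have hd: "fst (hd u) = \<pi> (Suc j)"
      using u by simp
    have "ws = map fst ?s @ map fst u"
      using arg_cong[OF pop(3), of "map fst"] pushed by simp
    then have ws: "ws = map fst ?s @ \<pi> (Suc j) # map fst (tl u)"
      using u(1) hd by (cases u) auto
    have "?s = take (length ?s) (zip ws (tl (ws @ [\<pi> (Suc j)])))"
      using pop(3) pushed by simp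
    also have "\<dots> = zip (map fst ?s) (tl (map fst ?s @ [\<pi> (Suc j)]))"
      using take_zip_tl[of "map fst ?s" "\<pi> (Suc j)" "map fst (tl u)" "[\<pi> (Suc j)]"] ws by simp
    finally have "?s = zip (map fst ?s) (tl (map fst ?s @ [\<pi> (Suc j)]))" .
    moreover have "distinct (map fst ?s @ [\<pi> (Suc j)])"
      using vs(1) ws unfolding ws_def[symmetric] by simp
    moreover have "set ?s \<subseteq> edges A"
      using arg_cong[OF pop(3), of set] vs(3) edge by (metis Un_subset_iff empty_subsetI insert_subset list.set set_append)
    ultimately show ?thesis
      by blast
  qed
qed

text \<open>Distinct vertices make the edges on a stack distinct, and finitely many edges form only
  finitely many distinct lists.\<close>

lemma finite_range_stack:
  assumes "is_arena A" "is_play A \<pi>"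
  shows "finite (range (stack A \<pi>))"
proof -
  have "finite (edges A)"
    using assms(1) unfolding is_arena_def verts_def by (meson finite_SigmaI finite_UnI finite_subset)
  moreover have "range (stack A \<pi>) \<subseteq> {s. set s \<subseteq> edges A \<and> distinct s}"
  proof (intro subsetI CollectI)
    fix s
    assume "s \<in> range (stack A \<pi>)"
    then show "set s \<subseteq> edges A \<and> distinct s"
      using stack_simple_path[OF assms(2)] distinct_zipI1 distinct_append by (metis rangeE)
  qed
  ultimately show ?thesis
    using finite_subset_distinct finite_subset by blast
qed

section \<open>Comparison of the two decompositions\<close>

theorem theorem5:
  fixes U :: "'u set" and Y :: "'u list set" and A :: "('v, 'u) arena"
  assumes "Y \<subseteq> lists U"
    and "closed_under_cyclic_permutations U Y"
    and "closed_under_concatenation U Y"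
    and "closed_under_concatenation U (lists U - Y)"
    and "is_arena A"
    and "labels A = U"
  shows "unambiguous Y A"
proof -
  have False if "\<pi> \<in> O_EAC Y A" "\<pi> \<in> O_EAC (lists U - Y) A" for \<pi>
  proof -
    obtain a b where play: "is_play A \<pi>"
      and a: "\<And>u. Some u \<in> range (cycles A (suffix a \<pi>)) \<Longrightarrow> map (lab A) u \<in> Y"
      and b: "\<And>u. Some u \<in> range (cycles A (suffix b \<pi>)) \<Longrightarrow> map (lab A) u \<in> lists U - Y"
      using \<open>\<pi> \<in> O_EAC Y A\<close> \<open>\<pi> \<in> O_EAC (lists U - Y) A\<close> unfolding O_EAC_def by blast
    \<comment> \<open>Position \<open>a + b\<close> lies in both suffixes; the shifts by
      \<open>b\<close> and \<open>a\<close> align the two runs, so that both push \<open>e t\<close>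
      at time \<open>t\<close>.\<close>
    define e where "e t = (\<pi> (a + b + t), \<pi> (Suc (a + b + t)))" for t
    define sa where "sa t = stack A (suffix a \<pi>) (b + t)" for t
    define sb where "sb t = stack A (suffix b \<pi>) (a + t)" for t
    interpret Y: rotation_concatenation_closed "{w. map (lab A) w \<in> insert [] Y}"
      using rotation_concatenation_closed_labels assms(1,3) cyclic_permutation_append[OF assms(2,1)]
      by blast
    interpret N: rotation_concatenation_closed "{w. map (lab A) w \<in> insert [] (lists U - Y)}"
    proof (rule rotation_concatenation_closed_labels[OF _ assms(4)])
      \<comment> \<open>Rotations are undone by rotations: \<open>y @ x\<close> in \<open>Y\<close>
        would put \<open>x @ y\<close> in \<open>Y\<close>.\<close>
      show "y @ x \<in> lists U - Y" if "x @ y \<in> lists U - Y" for x y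
        using that cyclic_permutation_append[OF assms(2,1), of y x] by auto
    qed blast
    have step_a: "sa (Suc j) = sa j @ [e j] \<or>
      (\<exists>c\<in>{w. map (lab A) w \<in> insert [] Y}. sa j @ [e j] = sa (Suc j) @ c)" for j
    proof (cases rule: stack_cases[of A "suffix a \<pi>" "b + j"])
      case push
      then show ?thesis
        by (simp add: sa_def e_def ac_simps)
    next
      case (pop u)
      then have "map (lab A) u \<in> Y"
        using a by (metis rangeI)
      then show ?thesis
        using pop(3) by (intro disjI2 bexI[of _ u]) (simp_all add: sa_def e_def ac_simps)
    qed
    have step_b: "sb (Suc j) = sb j @ [e j] \<or>
      (\<exists>c\<in>{w. map (lab A) w \<in> insert [] (lists U - Y)}. sb j @ [e j] = sb (Suc j) @ c)" for j
    proof (cases rule: stack_cases[of A "suffix b \<pi>" "a + j"])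
      case push
      then show ?thesis
        by (simp add: sb_def e_def ac_simps)
    next
      case (pop u)
      then have "map (lab A) u \<in> lists U - Y"
        using b by (metis rangeI)
      then show ?thesis
        using pop(3) by (intro disjI2 bexI[of _ u]) (simp_all add: sb_def e_def ac_simps)
    qed
    have "is_play A (suffix k \<pi>)" for k
      using play by (simp add: is_play_def)
    then have "finite (range (stack A (suffix a \<pi>)) \<times> range (stack A (suffix b \<pi>)))"
      using finite_range_stack[OF assms(5)] by blast
    then have "finite (range (\<lambda>t. (sa t, sb t)))"
      by (rule finite_subset[rotated]) (auto simp: sa_def sb_def)
    \<comment> \<open>Pigeonhole on pairs makes both stacks repeat at the same two times.\<close>
    then have "\<not> inj (\<lambda>t. (sa t, sb t))"
      using finite_imageD by blast
    then obtain m n where "sa m = sa n" "sb m = sb n" "m < n"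
      unfolding inj_on_def by (metis linorder_neqE_nat prod.inject)
    \<comment> \<open>As \<open>m < n\<close>, the segment is not the adjoined empty word, so its
      label lies in both \<open>Y\<close> and the complement.\<close>
    then have "map (lab A) (map e [m..<n]) \<in> insert [] Y"
      "map (lab A) (map e [m..<n]) \<in> insert [] (lists U - Y)" "map (lab A) (map e [m..<n]) \<noteq> []"
      using Y.segment_between_equal_stacks[of sa e m n, OF step_a]
        N.segment_between_equal_stacks[of sb e m n, OF step_b]
      by simp_all
    then show False
      by blast
  qed
  then show ?thesis
    using assms(6) unfolding unambiguous_def by blast
qed

end
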